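(* Let $X$ be a separable Banach space which is not quasireflexive. Then for every countable ordinal $\alpha$ there exists a linear (not necessarily closed) subspace $\Gamma \subset X^{*}$ such that $\Gamma_{(\alpha)} \neq \Gamma_{(\alpha+1)} = X^{*}$.
   Context: A Banach space $X$ is quasireflexive if $\dim(X^{**}/\pi(X))<\infty$, where $\pi: X\to X^{**}$ is the canonical embedding. For a subset $\Gamma\subset X^*$, the weak$^*$-derived set $\Gamma_{(1)}$ is the set of all limits of weak$^*$-convergent sequences of elements of $\Gamma$. Weak$^*$-derived sets of arbitrary ordinal order are defined inductively by $\Gamma_{(0)}=\Gamma$ and $\Gamma_{(\alpha)}=\bigcup_{\beta<\alpha}(\Gamma_{(\beta)})_{(1)}$ for $\alpha\ge 1$. *)

theory Defs
  imports "HOL-Analysis.Analysis"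
begin

definition canon_emb :: "'a::banach \<Rightarrow> (('a \<Rightarrow>\<^sub>L real) \<Rightarrow>\<^sub>L real)" where
  "canon_emb x = Blinfun (\<lambda>f. blinfun_apply f x)"

text \<open>Quasireflexive: the quotient X**/pi(X) is finite-dimensional, i.e. finitely many
  elements of X** together with pi(X) span X**.\<close>
definition quasireflexive :: "'a::banach itself \<Rightarrow> bool" where
  "quasireflexive TYPE('a) \<longleftrightarrow>
     (\<exists>F :: (('a \<Rightarrow>\<^sub>L real) \<Rightarrow>\<^sub>L real) set.
        finite F \<and> span (F \<union> range (canon_emb :: 'a \<Rightarrow> _)) = UNIV)"

definition wstar_derived1 :: "('a::banach \<Rightarrow>\<^sub>L real) set \<Rightarrow> ('a \<Rightarrow>\<^sub>L real) set" where
  "wstar_derived1 \<Gamma> = {f. \<exists>s. (\<forall>n. s n \<in> \<Gamma>) \<and>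
       (\<forall>x. (\<lambda>n. blinfun_apply (s n) x) \<longlonglongrightarrow> blinfun_apply f x)}"

text \<open>Transfinite weak* derived sets along a well-order r: the element i of Field r
  whose initial segment has order type beta gets Gamma_(beta).
  Gamma_(0) = Gamma, and Gamma_(beta) = Union over gamma < beta of (Gamma_(gamma))_(1) for beta >= 1.\<close>
definition wstar_derived :: "('i \<times> 'i) set \<Rightarrow> ('a::banach \<Rightarrow>\<^sub>L real) set \<Rightarrow> 'i \<Rightarrow> ('a \<Rightarrow>\<^sub>L real) set" where
  "wstar_derived r \<Gamma> = wfrec (r - Id)
     (\<lambda>G i. if (\<forall>j. (j, i) \<notin> r - Id) then \<Gamma>
            else (\<Union>j\<in>{j. (j, i) \<in> r - Id}. wstar_derived1 (G j)))"

end

theory Submission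
  imports Defs
begin

text \<open>
  Since \<open>X** / \<pi>(X)\<close> is infinite-dimensional, it carries a biorthogonal sequence; Helly's theorem
  turns it into an array \<open>z\<^sub>t\<^sub>,\<^sub>k\<close> in \<open>X\<close> (after Davis and Johnson), indexed by the nodes \<open>t\<close> of
  the tree of finite sequences and by \<open>k\<close>, such that for each \<open>t\<close> the sums \<open>\<Sum>\<^sub>k\<^sub><\<^sub>K z\<^sub>t\<^sub>,\<^sub>k\<close> are
  bounded, the array has a biorthogonal system which is weak* null along each row, and the functionals
  vanishing on all but finitely many \<open>z\<^sub>t\<^sub>,\<^sub>k\<close> are weak* sequentially dense. Formally
  \<open>f\<^sub>t = \<Sum>\<^sub>k z\<^sub>t\<^sub>,\<^sub>k\<close> is an element of \<open>X**\<close> outside \<open>\<pi>(X)\<close>.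

  Give the root rank \<open>\<alpha>\<close> and let the ranks of the children of a node of rank \<open>\<beta>\<close> be cofinal
  in \<open>\<beta>\<close>. The subspace \<open>\<Gamma>\<close> consists of the functionals \<open>y\<close> with
  \<open>y(z\<^sub>t\<^sub>,\<^sub>k) = \<epsilon> f\<^sub>u(y)\<close> for every ranked child \<open>u = k # t\<close>, where \<open>\<epsilon>\<close> decays
  geometrically in \<open>k\<close>, and with \<open>f\<^sub>[\<^sub>](y) = 0\<close> at the root. The relations at the children of \<open>t\<close>
  make \<open>f\<^sub>t\<close> weak* sequentially continuous, so one passage to limits can only destroy relations
  of the lowest surviving rank, and the one at the root is still valid on \<open>\<Gamma>\<^sub>(\<^sub>\<alpha>\<^sub>)\<close>. Conversely,
  a broken relation at \<open>t\<close> is repaired by adding a multiple of a late member of the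
  biorthogonal row of \<open>t\<close>, which costs only one broken relation at a child of \<open>t\<close>.
\<close>

section \<open>The Hahn-Banach theorem and Helly's theorem\<close>

text \<open>Scaling is demanded as an inequality only, which passes easily to infima;
  \<open>sublinear_scale\<close> recovers equality.\<close>

definition sublinear :: "('a::real_vector \<Rightarrow> real) \<Rightarrow> bool" where
  "sublinear p \<longleftrightarrow> (\<forall>x y. p (x + y) \<le> p x + p y) \<and> (\<forall>c\<ge>0. \<forall>x. p (c *\<^sub>R x) \<le> c * p x)"

lemma sublinear_add: "sublinear p \<Longrightarrow> p (x + y) \<le> p x + p y"
  by (simp add: sublinear_def)

lemma sublinear_0:
  assumes "sublinear p" shows "p 0 = 0"
proof -
  have "p (0 *\<^sub>R 0) \<le> 0 * p 0" "p (0 + 0) \<le> p 0 + p 0"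
    using assms unfolding sublinear_def by blast+
  then show ?thesis by simp
qed

lemma sublinear_scale:
  assumes "sublinear p" "c \<ge> 0" shows "p (c *\<^sub>R x) = c * p x"
proof (cases "c = 0")
  case False
  have "p ((1/c) *\<^sub>R (c *\<^sub>R x)) \<le> (1/c) * p (c *\<^sub>R x)" "p (c *\<^sub>R x) \<le> c * p x"
    using assms False unfolding sublinear_def by (meson zero_le_divide_1_iff)+
  with False assms(2) show ?thesis by (simp add: field_simps)
qed (use sublinear_0[OF assms(1)] in simp)

lemma sublinear_minus: "sublinear p \<Longrightarrow> - p (- x) \<le> p x"
  using sublinear_add[of p x "-x"] sublinear_0[of p] by simp

text \<open>Take the infimum over \<open>t \<ge> 0\<close> of
  \<open>q (x + t *\<^sub>R v) - t * q v\<close>, which subadditivity keeps above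
  \<open>- q (- x)\<close>. For minimal \<open>q\<close> the last bound becomes
  superadditivity.\<close>

lemma sublinear_improve:
  fixes q :: "'a::real_vector \<Rightarrow> real"
  assumes q: "sublinear q"
  obtains q' where "sublinear q'" "\<And>x. q' x \<le> q x" "\<And>x. q' x \<le> q (x + v) - q v"
proof -
  define h where "h x t = q (x + t *\<^sub>R v) - t * q v" for x t
  define q' where "q' x = (INF t\<in>{0..}. h x t)" for x
  have low: "- q (- x) \<le> h x t" if "t \<ge> 0" for x t
    using sublinear_add[OF q, of "x + t *\<^sub>R v" "-x"] sublinear_scale[OF q that, of v]
    by (simp add: h_def)
  have bdd: "bdd_below (h x ` {0..})" for x
    using low by (intro bdd_belowI2[where m="- q (- x)"]) auto
  have le: "q' x \<le> h x t" if "t \<ge> 0" for x t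
    unfolding q'_def by (rule cINF_lower[OF bdd]) (use that in auto)
  have ge: "m \<le> q' x" if "\<And>t. t \<ge> 0 \<Longrightarrow> m \<le> h x t" for m x
    unfolding q'_def by (rule cINF_greatest) (use that in auto)
  show ?thesis
  proof (rule that[of q'])
    show "q' x \<le> q x" for x using le[of 0 x] by (simp add: h_def)
    show "q' x \<le> q (x + v) - q v" for x using le[of 1 x] by (simp add: h_def)
    have "q' (x + y) \<le> q' x + q' y" for x y
    proof -
      have "q' (x + y) \<le> h x t + h y u" if "t \<ge> 0" "u \<ge> 0" for t u
        using le[of "t + u" "x + y"] that
          sublinear_add[OF q, of "x + t *\<^sub>R v" "y + u *\<^sub>R v"]
        by (simp add: h_def algebra_simps)
      then have "q' (x + y) - h x t \<le> q' y" if "t \<ge> 0" for t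
        using that by (intro ge) (simp add: algebra_simps)
      then have "q' (x + y) - q' y \<le> q' x"
        by (intro ge) (simp add: algebra_simps)
      then show ?thesis by simp
    qed
    moreover have "q' (c *\<^sub>R x) \<le> c * q' x" if "c \<ge> 0" for c x
    proof (cases "c = 0")
      case True
      then show ?thesis using le[of 0 0] sublinear_0[OF q] by (simp add: h_def)
    next
      case False
      have "q' (c *\<^sub>R x) / c \<le> q' x"
      proof (rule ge)
        fix t :: real assume "t \<ge> 0"
        then have "q' (c *\<^sub>R x) \<le> h (c *\<^sub>R x) (c * t)" using that le by simp
        also have "\<dots> = c * h x t"
          using sublinear_scale[OF q that, of "x + t *\<^sub>R v"] by (simp add: h_def algebra_simps)
        finally show "q' (c *\<^sub>R x) / c \<le> h x t" using False that by (simp add: field_simps)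
      qed
      then show ?thesis using False that by (simp add: field_simps)
    qed
    ultimately show "sublinear q'" by (simp add: sublinear_def)
  qed
qed

text \<open>Zorn's lemma applies: the pointwise infimum of a chain stays above
  \<open>- p (- x)\<close>, and it is subadditive because any two members of the chain are
  comparable.\<close>

lemma minimal_sublinear:
  fixes p :: "'a::real_vector \<Rightarrow> real"
  assumes p: "sublinear p"
  obtains q where "sublinear q" "q \<le> p" "\<And>q'. sublinear q' \<Longrightarrow> q' \<le> q \<Longrightarrow> q' = q"
proof -
  let ?A = "{q. sublinear q \<and> q \<le> p}"
  have "\<exists>m\<in>?A. \<forall>a\<in>?A. a \<le> m \<longrightarrow> a = m"
  proof (rule predicate_Zorn)
    show "partial_order_on ?A (relation_of (\<lambda>a b. b \<le> a) ?A)"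
      by (rule partial_order_on_relation_ofI) auto
    fix C assume "C \<in> Chains (relation_of (\<lambda>a b. b \<le> a) ?A)"
    then have CA: "\<And>q. q \<in> C \<Longrightarrow> sublinear q \<and> q \<le> p"
      and ch: "\<And>q q'. q \<in> C \<Longrightarrow> q' \<in> C \<Longrightarrow> q \<le> q' \<or> q' \<le> q"
      unfolding Chains_def relation_of_def by blast+
    show "\<exists>u\<in>?A. \<forall>a\<in>C. u \<le> a"
    proof (cases "C = {}")
      case True
      then show ?thesis using p by auto
    next
      case False
      define u where "u x = (INF q\<in>C. q x)" for x
      have bdd: "bdd_below ((\<lambda>q. q x) ` C)" for x
      proof (intro bdd_belowI2)
        fix q assume "q \<in> C"
        then have "- q (- x) \<le> q x" "q (- x) \<le> p (- x)"
          using CA sublinear_minus by (auto simp: le_fun_def)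
        then show "- p (- x) \<le> q x" by simp
      qed
      have le: "u x \<le> q x" if "q \<in> C" for q x
        unfolding u_def by (rule cINF_lower[OF bdd that])
      have ge: "m \<le> u x" if "\<And>q. q \<in> C \<Longrightarrow> m \<le> q x" for m x
        unfolding u_def by (rule cINF_greatest) (use that False in auto)
      have "u (x + y) \<le> u x + u y" for x y
      proof -
        have *: "u (x + y) \<le> q x + q' y" if "q \<in> C" "q' \<in> C" for q q'
        proof -
          obtain q0 where "q0 \<in> C" "q0 \<le> q" "q0 \<le> q'"
            using ch[OF \<open>q \<in> C\<close> \<open>q' \<in> C\<close>] \<open>q \<in> C\<close> \<open>q' \<in> C\<close> by blast
          then show ?thesis using le[of q0 "x + y"] CA[of q0] sublinear_add[of q0 x y]
            by (smt (verit) le_fun_def)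
        qed
        have "u (x + y) - q x \<le> u y" if "q \<in> C" for q
          by (rule ge) (use *[OF that] in \<open>simp add: algebra_simps\<close>)
        then have "u (x + y) - u y \<le> u x"
          by (intro ge) (simp add: algebra_simps)
        then show ?thesis by simp
      qed
      moreover have "u (c *\<^sub>R x) \<le> c * u x" if "c \<ge> 0" for c x
      proof (cases "c = 0")
        case True
        obtain q where "q \<in> C" using False by auto
        then show ?thesis using True le[of q 0] CA[of q] sublinear_0[of q] by simp
      next
        case False
        have "u (c *\<^sub>R x) / c \<le> u x"
        proof (rule ge)
          fix q assume "q \<in> C"
          then have "u (c *\<^sub>R x) \<le> c * q x"
            using le[of q "c *\<^sub>R x"] CA[of q] sublinear_scale[of q c x] that by simp
          then show "u (c *\<^sub>R x) / c \<le> q x" using False that by (simp add: field_simps)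
        qed
        then show ?thesis using False that by (simp add: field_simps)
      qed
      ultimately have "sublinear u" by (simp add: sublinear_def)
      moreover have *: "\<forall>a\<in>C. u \<le> a" using le by (simp add: le_fun_def)
      moreover have "u \<le> p" using * CA False by (meson equals0I order_trans)
      ultimately show ?thesis by blast
    qed
  qed
  then show ?thesis using that by (smt (verit) mem_Collect_eq order_trans)
qed

text \<open>A minimal sublinear functional is linear; passing first to some \<open>p' \<le> p\<close> with
  \<open>p' (- v) \<le> - p v\<close> forces the value at \<open>v\<close>.\<close>
lemma Hahn_Banach_dominated:
  fixes p :: "'a::real_vector \<Rightarrow> real"
  assumes p: "sublinear p"
  obtains \<phi> where "linear \<phi>" "\<And>x. \<phi> x \<le> p x" "\<phi> v = p v"
proof -
  obtain p' where p': "sublinear p'" "\<And>x. p' x \<le> p x" "\<And>x. p' x \<le> p (x + v) - p v"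
    using sublinear_improve[OF p] by metis
  obtain q where q: "sublinear q" "q \<le> p'" "\<And>q'. sublinear q' \<Longrightarrow> q' \<le> q \<Longrightarrow> q' = q"
    using minimal_sublinear[OF p'(1)] by metis
  have super: "q x + q y \<le> q (x + y)" for x y
  proof -
    obtain q' where "sublinear q'" "\<And>x. q' x \<le> q x" "\<And>x. q' x \<le> q (x + y) - q y"
      using sublinear_improve[OF q(1)] by metis
    with q(3)[of q'] show ?thesis by (metis add.commute le_diff_eq le_fun_def)
  qed
  have add: "q (x + y) = q x + q y" for x y
    using super sublinear_add[OF q(1)] by (simp add: order_antisym)
  have neg: "q (- x) = - q x" for x
    using add[of x "-x"] sublinear_0[OF q(1)] by simp
  have "q (c *\<^sub>R x) = c * q x" for c x
  proof (cases "c \<ge> 0")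
    case False
    then have "q (- (c *\<^sub>R x)) = - c * q x"
      using sublinear_scale[OF q(1), of "-c" x] by simp
    then show ?thesis using neg by simp
  qed (use sublinear_scale[OF q(1)] in simp)
  with add have lin: "linear q" by (intro linearI) auto
  have le: "q x \<le> p x" for x using q(2) p'(2) by (meson le_fun_def order_trans)
  have "q (- v) \<le> - p v"
    using q(2) p'(3)[of "-v"] sublinear_0[OF p] by (simp add: le_fun_def) (meson order_trans)
  with neg le[of v] have "q v = p v" by simp
  then show ?thesis using that lin le by blast
qed

lemma infdist_approximant:
  assumes "subspace S" "e > 0"
  obtains s where "s \<in> S" "norm (x - s) < infdist x S + e"
proof -
  have "S \<noteq> {}" using assms(1) subspace_0 by auto
  moreover have "bdd_below (dist x ` S)" by (intro bdd_belowI2[where m=0]) simp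
  moreover have "(INF s\<in>S. dist x s) < infdist x S + e"
    using calculation(1) assms(2) by (simp add: infdist_notempty)
  ultimately obtain s where "s \<in> S" "dist x s < infdist x S + e"
    using cINF_less_iff by meson
  then show ?thesis using that by (simp add: dist_norm)
qed

text \<open>The distance to \<open>S\<close> is sublinear, and a linear functional below it vanishes
  on \<open>S\<close> and has norm at most 1 at once.\<close>

lemma Hahn_Banach_distance:
  fixes S :: "'a::real_normed_vector set"
  assumes S: "subspace S"
  obtains \<phi> :: "'a \<Rightarrow>\<^sub>L real"
  where "\<And>s. s \<in> S \<Longrightarrow> \<phi> s = 0" "\<phi> x = infdist x S" "norm \<phi> \<le> 1"
proof -
  have le: "infdist y S \<le> norm (y - s)" if "s \<in> S" for s y
    using infdist_le[OF that, of y] by (simp add: dist_norm)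
  have "infdist (y + z) S \<le> infdist y S + infdist z S" for y z
  proof (rule field_le_epsilon)
    fix e :: real assume "e > 0"
    then obtain s t where s: "s \<in> S" "norm (y - s) < infdist y S + e/2"
      and t: "t \<in> S" "norm (z - t) < infdist z S + e/2"
      using infdist_approximant[OF S, of "e/2"] by (metis half_gt_zero)
    have "infdist (y + z) S \<le> norm ((y + z) - (s + t))"
      using le S s t subspace_add by blast
    also have "\<dots> \<le> norm (y - s) + norm (z - t)"
      by (metis add_diff_add norm_triangle_ineq)
    finally show "infdist (y + z) S \<le> infdist y S + infdist z S + e" using s t by simp
  qed
  moreover have "infdist (c *\<^sub>R y) S \<le> c * infdist y S" if "c \<ge> 0" for c y
  proof (cases "c = 0")
    case True
    then show ?thesis using S subspace_0 infdist_zero by fastforce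
  next
    case False
    show ?thesis
    proof (rule field_le_epsilon)
      fix e :: real assume "e > 0"
      then have "e/c > 0" using False that by simp
      then obtain s where s: "s \<in> S" "norm (y - s) < infdist y S + e/c"
        by (rule infdist_approximant[OF S])
      have "infdist (c *\<^sub>R y) S \<le> norm (c *\<^sub>R y - c *\<^sub>R s)"
        using le S s subspace_scale by blast
      also have "\<dots> = c * norm (y - s)"
        using that by (simp flip: scaleR_diff_right)
      also have "\<dots> \<le> c * (infdist y S + e/c)"
        using s that by (intro mult_left_mono) auto
      finally show "infdist (c *\<^sub>R y) S \<le> c * infdist y S + e"
        using False by (simp add: algebra_simps)
    qed
  qed
  ultimately have "sublinear (\<lambda>y. infdist y S)" by (simp add: sublinear_def)
  then obtain \<phi> where \<phi>: "linear \<phi>" "\<And>y. \<phi> y \<le> infdist y S" "\<phi> x = infdist x S"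
    using Hahn_Banach_dominated by blast
  have neg: "\<phi> (- y) = - \<phi> y" for y using \<phi>(1) by (rule linear_neg)
  have bound: "\<bar>\<phi> y\<bar> \<le> norm y" for y
    using \<phi>(2)[of y] \<phi>(2)[of "-y"] le[of 0 y] le[of 0 "-y"] S subspace_0 neg by fastforce
  have bl: "bounded_linear \<phi>"
    using \<phi>(1) bound by (intro bounded_linear_intro[where K=1]) (auto simp: linear_add linear_scale)
  show ?thesis
  proof (rule that[of "Blinfun \<phi>"])
    show "Blinfun \<phi> s = 0" if "s \<in> S" for s
      using \<phi>(2)[of s] \<phi>(2)[of "-s"] that S subspace_neg[OF S that] neg
      by (simp add: bounded_linear_Blinfun_apply[OF bl])
    show "Blinfun \<phi> x = infdist x S" by (simp add: bounded_linear_Blinfun_apply[OF bl] \<phi>(3))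
    show "norm (Blinfun \<phi>) \<le> 1"
      using bound by (intro norm_blinfun_bound) (auto simp: bounded_linear_Blinfun_apply[OF bl])
  qed
qed

corollary Hahn_Banach_separation:
  fixes S :: "'a::real_normed_vector set"
  assumes S: "subspace S" "closed S" and "x \<notin> S"
  obtains \<phi> :: "'a \<Rightarrow>\<^sub>L real" where "\<And>s. s \<in> S \<Longrightarrow> \<phi> s = 0" "\<phi> x = 1"
proof -
  obtain \<phi> :: "'a \<Rightarrow>\<^sub>L real" where \<phi>: "\<And>s. s \<in> S \<Longrightarrow> \<phi> s = 0" "\<phi> x = infdist x S"
    using Hahn_Banach_distance[OF S(1)] by metis
  have "S \<noteq> {}" using S(1) subspace_0 by auto
  then have "infdist x S \<noteq> 0" using assms in_closed_iff_infdist_zero by blast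
  then show ?thesis
    using \<phi> that[of "(1 / infdist x S) *\<^sub>R \<phi>"] by (simp add: blinfun.scaleR_left)
qed

section \<open>Finite interpolation and Helly's theorem\<close>

text \<open>Induction on \<open>A\<close>: if some \<open>v\<close> is killed by \<open>A\<close>
  but not by the new \<open>a\<close>, subtracting a multiple of \<open>a\<close> from
  \<open>y\<close> makes it vanish at \<open>v\<close>; otherwise \<open>a\<close> imposes no
  condition beyond those of \<open>A\<close>.\<close>

lemma vanishing_on_common_kernel_in_span:
  fixes A :: "('a::real_normed_vector \<Rightarrow>\<^sub>L real) set"
  assumes "finite A" "\<And>x. (\<forall>a\<in>A. blinfun_apply a x = 0) \<Longrightarrow> blinfun_apply y x = 0"
  shows "y \<in> span A"
  using assms
proof (induction A arbitrary: y rule: finite_induct)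
  case empty
  then have "y = 0" by (intro blinfun_eqI) simp
  then show ?case by simp
next
  case (insert a A)
  show ?case
  proof (cases "\<exists>v. (\<forall>b\<in>A. blinfun_apply b v = 0) \<and> blinfun_apply a v \<noteq> 0")
    case True
    then obtain v where v: "\<And>b. b \<in> A \<Longrightarrow> blinfun_apply b v = 0" "blinfun_apply a v \<noteq> 0" by blast
    define y' where "y' = y - (y v / a v) *\<^sub>R a"
    have "y' \<in> span A"
    proof (rule insert.IH)
      fix x assume x: "\<forall>b\<in>A. blinfun_apply b x = 0"
      have "blinfun_apply y (x - (a x / a v) *\<^sub>R v) = 0"
        by (rule insert.prems) (use x v in \<open>auto simp: blinfun.bilinear_simps\<close>)
      then show "blinfun_apply y' x = 0"
        by (simp add: y'_def blinfun.bilinear_simps)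
    qed
    then have "y' + (y v / a v) *\<^sub>R a \<in> span (insert a A)"
      by (meson insertI1 span_add span_base span_mono span_scale subsetD subset_insertI)
    then show ?thesis by (simp add: y'_def)
  next
    case False
    then have "y \<in> span A" using insert.prems by (intro insert.IH) auto
    then show ?thesis by (meson span_mono subsetD subset_insertI)
  qed
qed

lemma interpolate_finite:
  fixes A :: "('a::real_normed_vector \<Rightarrow>\<^sub>L real) set" and f :: "('a \<Rightarrow>\<^sub>L real) \<Rightarrow> real"
  assumes "finite A" "linear f"
  shows "\<exists>x. \<forall>a\<in>A. blinfun_apply a x = f a"
  using assms(1)
proof (induction A rule: finite_induct)
  case (insert a A)
  then obtain x where x: "\<And>b. b \<in> A \<Longrightarrow> blinfun_apply b x = f b" by blast
  show ?case
  proof (cases "a \<in> span A")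
    case True
    have "subspace {b. blinfun_apply b x = f b}"
      using assms(2) by (auto simp: subspace_def blinfun.bilinear_simps linear_add linear_scale linear_0)
    then have "span A \<subseteq> {b. blinfun_apply b x = f b}"
      using x by (intro span_minimal) auto
    then show ?thesis using True x by auto
  next
    case False
    then obtain v where v: "\<And>b. b \<in> A \<Longrightarrow> blinfun_apply b v = 0" "blinfun_apply a v \<noteq> 0"
      using vanishing_on_common_kernel_in_span[OF insert.hyps(1)] by blast
    show ?thesis
      by (rule exI[of _ "x + ((f a - a x) / a v) *\<^sub>R v"])
        (use v x in \<open>auto simp: blinfun.bilinear_simps\<close>)
  qed
qed simp

text \<open>An interpolating vector may be shifted by the common kernel \<open>N\<close> of
  \<open>A\<close>. Its distance to \<open>N\<close> is the value of a functional of norm at most 1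
  in \<open>span A\<close>, hence at most \<open>norm f\<close>; the slack 1 is there because the
  distance need not be attained.\<close>

lemma Helly:
  fixes f :: "('a::real_normed_vector \<Rightarrow>\<^sub>L real) \<Rightarrow>\<^sub>L real"
  assumes A: "finite A"
  obtains x where "norm x \<le> norm f + 1" "\<And>a. a \<in> A \<Longrightarrow> blinfun_apply a x = f a"
proof -
  obtain x0 where x0: "\<And>a. a \<in> A \<Longrightarrow> blinfun_apply a x0 = f a"
    using interpolate_finite[OF A] blinfun.bounded_linear_right bounded_linear.linear by blast
  define N where "N = {x. \<forall>a\<in>A. blinfun_apply a x = 0}"
  have N: "subspace N" by (auto simp: N_def subspace_def blinfun.bilinear_simps)
  obtain \<phi> :: "'a \<Rightarrow>\<^sub>L real"
    where \<phi>: "\<And>s. s \<in> N \<Longrightarrow> \<phi> s = 0" "\<phi> x0 = infdist x0 N" "norm \<phi> \<le> 1"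
    using Hahn_Banach_distance[OF N] by metis
  have "\<phi> \<in> span A"
    using \<phi>(1) by (intro vanishing_on_common_kernel_in_span[OF A]) (auto simp: N_def)
  moreover have "subspace {b. blinfun_apply b x0 = f b}"
    by (auto simp: subspace_def blinfun.bilinear_simps)
  then have "span A \<subseteq> {b. blinfun_apply b x0 = f b}"
    using x0 by (intro span_minimal) auto
  ultimately have "infdist x0 N = f \<phi>" using \<phi>(2) by auto
  also have "\<dots> \<le> norm f * norm \<phi>" using norm_blinfun[of f \<phi>] by simp
  also have "\<dots> \<le> norm f" using \<phi>(3) by (simp add: mult_left_le)
  finally have d: "infdist x0 N \<le> norm f" .
  obtain s where "s \<in> N" "norm (x0 - s) < infdist x0 N + 1"
    by (rule infdist_approximant[OF N zero_less_one])
  with d have s: "s \<in> N" "norm (x0 - s) \<le> norm f + 1" by linarith+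
  show ?thesis
    by (rule that[of "x0 - s"]) (use s x0 in \<open>auto simp: N_def blinfun.bilinear_simps\<close>)
qed

section \<open>Weak* sequential convergence\<close>

text \<open>Uniform boundedness by Baire's theorem: the closed sets \<open>E k\<close> cover the
  space, so one of them contains a ball.\<close>

lemma pointwise_bounded_imp_norm_bounded:
  fixes s :: "nat \<Rightarrow> 'a::banach \<Rightarrow>\<^sub>L real"
  assumes "\<And>x. bounded (range (\<lambda>n. s n x))"
  obtains M where "M \<ge> 0" "\<And>n. norm (s n) \<le> M"
proof -
  define E where "E k = {x. \<forall>n. \<bar>s n x\<bar> \<le> real k}" for k :: nat
  have closed: "closed (E k)" for k
  proof -
    have "E k = (\<Inter>n. {x. \<bar>s n x\<bar> \<le> real k})" by (auto simp: E_def)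
    moreover have "closed {x. \<bar>s n x\<bar> \<le> real k}" for n
      by (intro closed_Collect_le continuous_intros)
    ultimately show ?thesis by auto
  qed
  have "x \<in> (\<Union>k. E k)" for x
  proof -
    obtain B where B: "\<And>n. \<bar>s n x\<bar> \<le> B"
      using assms[of x] by (auto simp: bounded_iff)
    obtain k :: nat where "B \<le> real k" using real_arch_simple by blast
    then have "x \<in> E k" using B by (auto simp: E_def intro: order_trans)
    then show ?thesis by blast
  qed
  then have UN: "\<Union>(range E) = UNIV" by blast
  have "\<exists>k. interior (E k) \<noteq> {}"
  proof (rule ccontr)
    assume "\<nexists>k. interior (E k) \<noteq> {}"
    then have "euclidean interior_of \<Union>(range E) = {}"
      using closed by (intro Baire_category_alt)
        (auto simp: completely_metrizable_space_euclidean)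
    then show False using UN by simp
  qed
  then obtain k x0 where "x0 \<in> interior (E k)" by blast
  then obtain e where e: "e > 0" "ball x0 e \<subseteq> E k"
    by (auto simp: mem_interior)
  have x0: "\<bar>s n x0\<bar> \<le> real k" for n
  proof -
    have "x0 \<in> E k" using e centre_in_ball by blast
    then show ?thesis by (simp add: E_def)
  qed
  show ?thesis
  proof (rule that[of "4 * real k / e"])
    show "norm (s n) \<le> 4 * real k / e" for n
    proof (rule norm_blinfun_bound)
      fix x
      show "norm (s n x) \<le> 4 * real k / e * norm x"
      proof (cases "x = 0")
        case False
        \<comment> \<open>Scaled to length \<open>e / 2\<close>, \<open>x\<close> shifts
          \<open>x0\<close> within the ball; the two values differ by at most \<open>2 * k\<close>,
          whence the factor 4.\<close>
        define c where "c = e / (2 * norm x)"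
        have c: "c > 0" using e False by (simp add: c_def)
        have "x0 + c *\<^sub>R x \<in> ball x0 e"
          using e False c by (simp add: dist_norm c_def)
        then have "\<bar>s n (x0 + c *\<^sub>R x)\<bar> \<le> real k" using e by (auto simp: E_def)
        then have "\<bar>c * s n x\<bar> \<le> 2 * real k"
          using x0[of n] by (simp add: blinfun.bilinear_simps)
        then have "c * \<bar>s n x\<bar> \<le> 2 * real k" using c by (simp add: abs_mult)
        then show ?thesis using e False by (simp add: c_def field_simps)
      qed simp
    qed (use e in simp)
  qed (use e in simp)
qed

lemma tendsto_on_dense:
  fixes s :: "nat \<Rightarrow> 'a::real_normed_vector \<Rightarrow>\<^sub>L real" and y :: "'a \<Rightarrow>\<^sub>L real"
  assumes dense: "closure D = UNIV" and bd: "\<And>n. norm (s n) \<le> M"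
    and conv: "\<And>d. d \<in> D \<Longrightarrow> (\<lambda>n. s n d) \<longlonglongrightarrow> y d"
  shows "(\<lambda>n. s n x) \<longlonglongrightarrow> y x"
proof (rule LIMSEQ_I)
  fix e :: real assume e: "e > 0"
  define L where "L = \<bar>M\<bar> + norm y + 1"
  have L: "L > 0" by (simp add: L_def add_nonneg_pos)
  have "x \<in> closure D" using dense by simp
  then obtain d where d: "d \<in> D" "dist d x < e / (2 * L)"
    using e L by (meson closure_approachable divide_pos_pos mult_pos_pos zero_less_numeral)
  obtain N where N: "\<And>n. n \<ge> N \<Longrightarrow> norm (s n d - y d) < e / 2"
    using LIMSEQ_D[OF conv[OF d(1)], of "e/2"] e by auto
  have "norm (s n x - y x) < e" if "n \<ge> N" for n
  proof -
    have "norm (s n - y) \<le> L"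
      using norm_triangle_ineq4[of "s n" y] bd[of n] by (simp add: L_def)
    then have "norm ((s n - y) (x - d)) \<le> L * norm (x - d)"
      using norm_blinfun[of "s n - y" "x - d"] by (meson mult_right_mono norm_ge_zero order_trans)
    also have "\<dots> < L * (e / (2 * L))"
      using d(2) L by (intro mult_strict_left_mono) (auto simp: dist_norm norm_minus_commute)
    also have "\<dots> = e / 2" using L by simp
    finally have "\<bar>(s n - y) (x - d)\<bar> < e / 2" by simp
    moreover have "s n x - y x = (s n - y) (x - d) + (s n d - y d)"
      by (simp add: blinfun.bilinear_simps)
    ultimately show ?thesis using N[OF that] unfolding real_norm_def by linarith
  qed
  then show "\<exists>N. \<forall>n\<ge>N. norm (s n x - y x) < e" by blast
qed

lemma dense_sequence:
  assumes "separable_space (euclidean :: 'a::real_normed_vector topology)"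
  obtains x :: "nat \<Rightarrow> 'a::real_normed_vector" where "closure (range x) = UNIV"
proof -
  obtain C :: "'a set" where C: "countable C" "closure C = UNIV"
    using assms by (auto simp: separable_space_def)
  then have "C \<noteq> {}" by auto
  then show ?thesis using that[of "from_nat_into C"] C by (simp add: range_from_nat_into)
qed

text \<open>Evaluation on a dense sequence embeds each ball of \<open>X\<^sup>*\<close> into the separable
  metrizable space \<open>\<real>\<^sup>\<nat>\<close>.\<close>
lemma wstar_sequentially_dense_sequence:
  assumes "separable_space (euclidean :: 'a::real_normed_vector topology)"
  obtains \<eta> :: "nat \<Rightarrow> 'a::real_normed_vector \<Rightarrow>\<^sub>L real"
  where "\<And>y. \<exists>\<sigma>. \<forall>x. (\<lambda>n. \<eta> (\<sigma> n) x) \<longlonglongrightarrow> blinfun_apply y x"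
proof -
  obtain x :: "nat \<Rightarrow> 'a" where x: "closure (range x) = UNIV"
    using dense_sequence[OF assms] by blast
  define ev :: "('a \<Rightarrow>\<^sub>L real) \<Rightarrow> nat \<Rightarrow> real" where "ev y = (\<lambda>q. y (x q))" for y
  define B where "B k = cball (0 :: 'a \<Rightarrow>\<^sub>L real) (real k)" for k :: nat
  \<comment> \<open>Working ball by ball keeps the approximants of \<open>y\<close> norm bounded, as
    \<open>tendsto_on_dense\<close> requires.\<close>
  have "\<exists>D. countable D \<and> D \<subseteq> B k \<and> ev ` B k \<subseteq> closure (ev ` D)" for k
  proof -
    obtain T where T: "countable T" "T \<subseteq> ev ` B k" "ev ` B k \<subseteq> closure T"
      using separable[of "ev ` B k"] by metis
    then obtain D where "D \<subseteq> B k" "countable D" "T = ev ` D"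
      by (metis countable_subset_image)
    then show ?thesis using T by blast
  qed
  then obtain D where D: "\<And>k. countable (D k)" "\<And>k. D k \<subseteq> B k" "\<And>k. ev ` B k \<subseteq> closure (ev ` D k)"
    by metis
  define E where "E = insert 0 (\<Union>k. D k)"
  have E: "countable E" "E \<noteq> {}" using D(1) by (auto simp: E_def)
  show ?thesis
  proof (rule that[of "from_nat_into E"])
    fix y :: "'a \<Rightarrow>\<^sub>L real"
    obtain k :: nat where "norm y \<le> real k" using real_arch_simple by blast
    then have "ev y \<in> ev ` B k" by (simp add: B_def)
    then have "ev y \<in> closure (ev ` D k)" using D(3) by blast
    then obtain g where g: "\<And>n. g n \<in> ev ` D k" "g \<longlonglongrightarrow> ev y"
      unfolding closure_sequential by blast
    then have "\<forall>n. \<exists>d. d \<in> D k \<and> g n = ev d" by blast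
    from choice[OF this] obtain h where h: "\<And>n. h n \<in> D k" "\<And>n. g n = ev (h n)" by blast
    have "(\<lambda>n. h n (x q)) \<longlonglongrightarrow> y (x q)" for q
    proof -
      have "(\<lambda>n. g n q) \<longlonglongrightarrow> ev y q"
        using continuous_on_tendsto_compose[OF continuous_on_product_coordinates g(2)] by simp
      then show ?thesis by (simp add: h ev_def)
    qed
    moreover have "norm (h n) \<le> real k" for n using h(1)[of n] D(2)[of k] by (auto simp: B_def)
    ultimately have lim: "(\<lambda>n. h n v) \<longlonglongrightarrow> y v" for v
      using tendsto_on_dense[OF x, of h "real k" y v] by auto
    have "h n \<in> E" for n using h(1) by (auto simp: E_def)
    then have "from_nat_into E (to_nat_on E (h n)) = h n" for n
      using E by (simp add: from_nat_into_to_nat_on)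
    then show "\<exists>\<sigma>. \<forall>v. (\<lambda>n. from_nat_into E (\<sigma> n) v) \<longlonglongrightarrow> y v"
      using lim by (intro exI[of _ "\<lambda>n. to_nat_on E (h n)"]) simp
  qed
qed

section \<open>The Davis-Johnson array\<close>

lemma canon_emb_apply [simp]: "blinfun_apply (canon_emb x) f = f x"
  unfolding canon_emb_def
  by (simp add: bounded_linear_Blinfun_apply blinfun.bounded_linear_left)

lemma bounded_linear_canon_emb: "bounded_linear (canon_emb :: 'a::banach \<Rightarrow> _)"
proof (rule bounded_linear_intro[where K=1])
  fix x :: 'a
  show "norm (canon_emb x) \<le> norm x * 1"
  proof (rule norm_blinfun_bound)
    show "norm (canon_emb x f) \<le> norm x * 1 * norm f" for f :: "'a \<Rightarrow>\<^sub>L real"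
      using norm_blinfun[of f x] by (simp add: mult.commute)
  qed simp
qed (auto intro!: blinfun_eqI simp: blinfun.bilinear_simps)

lemma norm_le_norm_canon_emb: "norm x \<le> norm (canon_emb x)"
proof -
  obtain \<phi> :: "'a \<Rightarrow>\<^sub>L real" where \<phi>: "\<phi> x = infdist x {0}" "norm \<phi> \<le> 1"
    by (rule Hahn_Banach_distance[OF subspace_single_0])
  then have "norm x = canon_emb x \<phi>" by (simp add: infdist_notempty)
  also have "\<dots> \<le> norm (canon_emb x) * norm \<phi>"
    using norm_blinfun[of "canon_emb x" \<phi>] by simp
  also have "\<dots> \<le> norm (canon_emb x)" using \<phi>(2) by (simp add: mult_left_le)
  finally show ?thesis .
qed

lemma closed_range_canon_emb: "closed (range (canon_emb :: 'a::banach \<Rightarrow> _))"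
proof -
  have "complete (range (canon_emb :: 'a \<Rightarrow> _))"
    by (rule complete_isometric_image[where e=1])
      (auto simp: bounded_linear_canon_emb norm_le_norm_canon_emb complete_UNIV)
  then show ?thesis by (simp add: complete_imp_closed)
qed

lemma subspace_range_canon_emb: "subspace (range (canon_emb :: 'a::banach \<Rightarrow> _))"
  by (intro linear_subspace_image bounded_linear.linear bounded_linear_canon_emb subspace_UNIV)

section \<open>A biorthogonal sequence modulo the canonical image\<close>

text \<open>Recursive choice: the canonical image together with the elements chosen so far spans a
  closed subspace, proper because the quotient is infinite-dimensional, so a further element can be
  separated from it.\<close>

lemma biorthogonal_modulo_canon_emb:
  assumes "\<not> quasireflexive TYPE('a::banach)"
  obtains f :: "nat \<Rightarrow> (('a::banach \<Rightarrow>\<^sub>L real) \<Rightarrow>\<^sub>L real)"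
    and \<phi> :: "nat \<Rightarrow> ((('a::banach \<Rightarrow>\<^sub>L real) \<Rightarrow>\<^sub>L real) \<Rightarrow>\<^sub>L real)"
  where "\<And>i j. \<phi> i (f j) = (if i = j then 1 else 0)" "\<And>i x. \<phi> i (canon_emb x) = 0"
proof -
  define P where "P h n r \<longleftrightarrow> snd r (fst r) = 1 \<and> (\<forall>x. snd r (canon_emb x) = 0) \<and>
      (\<forall>i<n. snd (h i) (fst r) = 0 \<and> snd r (fst (h i)) = 0)"
    for h :: "nat \<Rightarrow> (('a \<Rightarrow>\<^sub>L real) \<Rightarrow>\<^sub>L real) \<times> ((('a \<Rightarrow>\<^sub>L real) \<Rightarrow>\<^sub>L real) \<Rightarrow>\<^sub>L real)"
      and n :: nat
      and r :: "(('a \<Rightarrow>\<^sub>L real) \<Rightarrow>\<^sub>L real) \<times> ((('a \<Rightarrow>\<^sub>L real) \<Rightarrow>\<^sub>L real) \<Rightarrow>\<^sub>L real)"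
  have "\<exists>h. \<forall>n. P h n (h n)"
  proof (rule dependent_wellorder_choice[where P = P])
    show "P h n r = P h' n r" if "\<And>i. i < n \<Longrightarrow> h i = h' i" for r h h' n
      using that by (simp add: P_def)
    fix n h assume h: "\<And>i. i < n \<Longrightarrow> P h i (h i)"
    define f where "f i = fst (h i)" for i
    define \<phi> where "\<phi> i = snd (h i)" for i
    have bi: "\<phi> i (f j) = (if i = j then 1 else 0)" if "i < n" "j < n" for i j
      using h[OF that(1)] h[OF that(2)] by (cases i j rule: linorder_cases) (auto simp: P_def f_def \<phi>_def)
    have \<phi>0: "\<phi> i (canon_emb x) = 0" if "i < n" for i x
      using h[OF that] by (simp add: P_def \<phi>_def)
    \<comment> \<open>\<open>T\<close> projects along the \<open>f i\<close>; its values are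
      annihilated by the earlier \<open>\<phi> i\<close>.\<close>
    define T where "T u = u - (\<Sum>i<n. \<phi> i u *\<^sub>R f i)" for u
    have T_lin: "T (u + v) = T u + T v" "T (c *\<^sub>R u) = c *\<^sub>R T u" for u v c
      by (simp_all add: T_def blinfun.bilinear_simps algebra_simps sum.distrib scaleR_sum_right)
    \<comment> \<open>This is the canonical image plus the span of the \<open>f i\<close>; written
      as a preimage under the continuous \<open>T\<close>, it is visibly closed.\<close>
    define S where "S = {u. T u \<in> range canon_emb}"
    have T0: "T 0 = 0" by (simp add: T_def)
    have S_sub: "subspace S"
      using subspace_range_canon_emb unfolding subspace_def S_def mem_Collect_eq T_lin T0 by blast
    have "continuous_on UNIV T"
      unfolding T_def by (intro continuous_intros)
    then have S_closed: "closed S"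
      using closed_vimage[OF closed_range_canon_emb, of T] by (simp add: S_def vimage_def)
    have "S \<noteq> UNIV"
    proof
      assume S: "S = UNIV"
      have "u \<in> span (f ` {..<n} \<union> range canon_emb)" for u
      proof -
        have "T u \<in> range canon_emb" using S by (auto simp: S_def)
        then have "T u \<in> span (f ` {..<n} \<union> range canon_emb)" by (simp add: span_base)
        moreover have "(\<Sum>i<n. \<phi> i u *\<^sub>R f i) \<in> span (f ` {..<n} \<union> range canon_emb)"
          by (intro span_sum span_scale span_base) auto
        ultimately have "T u + (\<Sum>i<n. \<phi> i u *\<^sub>R f i) \<in> span (f ` {..<n} \<union> range canon_emb)"
          by (rule span_add)
        then show ?thesis by (simp add: T_def)
      qed
      then show False
        using assms unfolding quasireflexive_def by (metis UNIV_eq_I finite_imageI finite_lessThan)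
    qed
    then obtain g where "g \<notin> S" by blast
    obtain \<psi> :: "(('a \<Rightarrow>\<^sub>L real) \<Rightarrow>\<^sub>L real) \<Rightarrow>\<^sub>L real"
      where \<psi>: "\<And>s. s \<in> S \<Longrightarrow> \<psi> s = 0" "\<psi> g = 1"
      by (rule Hahn_Banach_separation[OF S_sub S_closed \<open>g \<notin> S\<close>]) (rule that, assumption+)
    have fS: "f j \<in> S" if "j < n" for j
    proof -
      have "(\<Sum>i<n. \<phi> i (f j) *\<^sub>R f i) = (\<Sum>i<n. if i = j then f i else 0)"
        using bi that by (intro sum.cong) auto
      also have "\<dots> = f j" using that by simp
      finally have "T (f j) = 0" by (simp add: T_def)
      then show ?thesis using subspace_0[OF subspace_range_canon_emb] by (simp add: S_def)
    qed
    have cS: "canon_emb x \<in> S" for x by (simp add: S_def T_def \<phi>0)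
    have "P h n (T g, \<psi>)"
    proof -
      have "\<psi> (T g) = 1"
        using \<psi> fS by (simp add: T_def blinfun.bilinear_simps blinfun.sum_right)
      moreover have "\<phi> i (T g) = 0" if "i < n" for i
      proof -
        have "(\<Sum>j<n. \<phi> j g * \<phi> i (f j)) = (\<Sum>j<n. if j = i then \<phi> j g else 0)"
          using bi that by (intro sum.cong) auto
        also have "\<dots> = \<phi> i g" using that by simp
        finally show ?thesis by (simp add: T_def blinfun.bilinear_simps blinfun.sum_right)
      qed
      ultimately show ?thesis using \<psi> fS cS by (simp add: P_def f_def \<phi>_def)
    qed
    then show "\<exists>r. P h n r" by blast
  qed
  then obtain h where h: "\<And>n. P h n (h n)" by blast
  have "snd (h i) (fst (h j)) = (if i = j then 1 else 0)" for i j
    using h[of i] h[of j] by (cases i j rule: linorder_cases) (auto simp: P_def)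
  moreover have "snd (h i) (canon_emb x) = 0" for i x using h[of i] by (simp add: P_def)
  ultimately show ?thesis using that[of "\<lambda>i. snd (h i)" "\<lambda>i. fst (h i)"] by blast
qed

text \<open>The triangular array of Davis and Johnson. The vectors \<open>s j i\<close> are approximants of the
  \<open>j\<close>-th functional \<open>f j\<close> outside \<open>\<pi>(X)\<close>, exact on the finite set \<open>A i\<close>; \<open>z\<close> is the array
  of their increments, all classes \<open>j \<le> i\<close> being updated at every time \<open>i = j + k\<close>.\<close>
lemma Davis_Johnson_array:
  assumes sep: "separable_space (euclidean :: 'a::banach topology)"
    and nqr: "\<not> quasireflexive TYPE('a)"
  obtains z :: "nat \<Rightarrow> nat \<Rightarrow> 'a::banach" and C :: "nat \<Rightarrow> real" and w :: "nat \<Rightarrow> nat \<Rightarrow> 'a::banach \<Rightarrow>\<^sub>L real"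
  where "\<And>j K. norm (\<Sum>k<K. z j k) \<le> C j"
    "\<And>j n i k. w j n (z i k) = (if i = j \<and> k = n then 1 else 0)"
    "\<And>j x. (\<lambda>n. w j n x) \<longlonglongrightarrow> 0"
    "\<And>y :: 'a::banach \<Rightarrow>\<^sub>L real. \<exists>s. (\<forall>n. finite {(i, k). blinfun_apply (s n) (z i k) \<noteq> 0}) \<and>
       (\<forall>x. (\<lambda>n. s n x) \<longlonglongrightarrow> y x)"
proof -
  obtain f :: "nat \<Rightarrow> (('a \<Rightarrow>\<^sub>L real) \<Rightarrow>\<^sub>L real)"
    and \<phi> :: "nat \<Rightarrow> ((('a \<Rightarrow>\<^sub>L real) \<Rightarrow>\<^sub>L real) \<Rightarrow>\<^sub>L real)"
    where bi: "\<And>i j. blinfun_apply (\<phi> i) (f j) = (if i = j then 1 else 0)"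
      and \<phi>0: "\<And>i x. \<phi> i (canon_emb x) = 0"
    by (rule biorthogonal_modulo_canon_emb[OF nqr]) (rule that, assumption+)
  obtain \<eta> :: "nat \<Rightarrow> 'a \<Rightarrow>\<^sub>L real"
    where \<eta>: "\<And>y. \<exists>\<sigma>. \<forall>x. (\<lambda>n. \<eta> (\<sigma> n) x) \<longlonglongrightarrow> blinfun_apply y x"
    using wstar_sequentially_dense_sequence[OF sep] by blast
  obtain x :: "nat \<Rightarrow> 'a" where x: "closure (range x) = UNIV"
    using dense_sequence[OF sep] by blast
  have "\<exists>s. finite A \<longrightarrow> norm s \<le> norm (f j) + 1 \<and> (\<forall>a\<in>A. blinfun_apply a s = f j a)" for A j
    using Helly by metis
  then obtain s0 where s0: "\<And>A j. finite A \<Longrightarrow> norm (s0 A j) \<le> norm (f j) + 1"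
    "\<And>A j a. finite A \<Longrightarrow> a \<in> A \<Longrightarrow> blinfun_apply a (s0 A j) = f j a"
    by metis
  \<comment> \<open>Helly's theorem one dual higher: \<open>w\<close> imitates
    \<open>\<phi> j\<close> on the images of the vectors in \<open>B\<close> and on
    \<open>f 0, ..., f i\<close>.\<close>
  define R where "R B i j w \<longleftrightarrow> norm w \<le> norm (\<phi> j) + 1 \<and> (\<forall>b\<in>B. blinfun_apply w b = 0) \<and>
     (\<forall>j'\<le>i. f j' w = (if j' = j then 1 else 0))" for B i j w
  have "\<exists>w. R B i j w" if "finite B" for B i j
  proof -
    have fin: "finite (canon_emb ` B \<union> f ` {..i})" using that by simp
    obtain w where w: "norm w \<le> norm (\<phi> j) + 1"
      "\<And>a. a \<in> canon_emb ` B \<union> f ` {..i} \<Longrightarrow> blinfun_apply a w = \<phi> j a"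
      by (rule Helly[OF fin, of "\<phi> j"]) (rule that, assumption+)
    have "blinfun_apply w b = 0" if "b \<in> B" for b
      using w(2)[of "canon_emb b"] that \<phi>0 by auto
    moreover have "f j' w = (if j' = j then 1 else 0)" if "j' \<le> i" for j'
      using w(2)[of "f j'"] that bi by auto
    ultimately show ?thesis using w(1) unfolding R_def by blast
  qed
  then have "\<exists>w0. \<forall>B i j. finite B \<longrightarrow> R B i j (w0 B i j)" by metis
  then obtain w0 where w0R: "\<And>B i j. finite B \<Longrightarrow> R B i j (w0 B i j)" by blast
  have w0: "finite B \<Longrightarrow> norm (w0 B i j) \<le> norm (\<phi> j) + 1"
    "finite B \<Longrightarrow> b \<in> B \<Longrightarrow> blinfun_apply (w0 B i j) b = 0"
    "finite B \<Longrightarrow> j' \<le> i \<Longrightarrow> f j' (w0 B i j) = (if j' = j then 1 else 0)" for B i j b j'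
    using w0R[of B i j] unfolding R_def by blast+
  \<comment> \<open>The two finite sets grow alternately. \<open>B\<close> collects vectors to be
    killed by the functionals chosen from now on: \<open>x i\<close> and the current approximants.
    \<open>A\<close> collects functionals on which later approximants are exact:
    \<open>\<eta> i\<close> and the \<open>w\<close> just chosen.\<close>
  define next_B where "next_B i A B = B \<union> {x i} \<union> s0 A ` {..i}" for i A B
  define next_A where "next_A i A B = A \<union> {\<eta> i} \<union> w0 (next_B i A B) i ` {..i}" for i A B
  define AB where "AB = rec_nat ({}, {}) (\<lambda>i (A, B). (next_A i A B, next_B i A B))"
  define A where "A i = fst (AB i)" for i
  define B where "B i = snd (AB i)" for i
  define s where "s j i = s0 (A i) j" for j i
  define W where "W j i = w0 (B (Suc i)) i j" for j i
  have B_Suc: "B (Suc i) = B i \<union> {x i} \<union> (\<lambda>j. s j i) ` {..i}" for i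
    by (simp add: B_def A_def AB_def s_def next_B_def case_prod_beta)
  have A_Suc: "A (Suc i) = A i \<union> {\<eta> i} \<union> (\<lambda>j. W j i) ` {..i}" for i
    by (simp add: B_def A_def AB_def W_def next_A_def case_prod_beta)
  have A0: "A 0 = {}" "B 0 = {}" by (simp_all add: A_def B_def AB_def)
  have finB: "finite (B i)" for i by (induction i) (simp_all add: A0 B_Suc)
  have finA: "finite (A i)" for i by (induction i) (simp_all add: A0 A_Suc)
  have monoA: "A i \<subseteq> A i'" if "i \<le> i'" for i i'
    by (rule lift_Suc_mono_le[OF _ that]) (simp add: A_Suc subset_iff)
  have monoB: "B i \<subseteq> B i'" if "i \<le> i'" for i i'
    by (rule lift_Suc_mono_le[OF _ that]) (simp add: B_Suc subset_iff)
  have s_A: "blinfun_apply a (s j i) = f j a" if "a \<in> A i0" "i0 \<le> i" for a j i i0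
    using that monoA s0(2)[OF finA] unfolding s_def by blast
  \<comment> \<open>In time, \<open>W j i\<close> sees the approximants of class \<open>j'\<close>
    as a step function, zero up to time \<open>i\<close> and constant afterwards, so it detects a
    single increment.\<close>
  have s_W: "blinfun_apply (W j i) (s j' i') = (if i' \<le> i then 0 else f j' (W j i))"
    if "j \<le> i" "j' \<le> i'" for j i j' i'
  proof (cases "i' \<le> i")
    case True
    then have "s j' i' \<in> B (Suc i)"
      using that(2) monoB[of "Suc i'" "Suc i"] by (auto simp: B_Suc)
    then show ?thesis using w0(2)[OF finB] True by (simp add: W_def)
  next
    case False
    have "W j i \<in> A (Suc i)" using that by (simp add: A_Suc)
    then show ?thesis using False by (simp add: s_A[of _ "Suc i"])
  qed
  define z where "z j k = s j (Suc (j + k)) - s j (j + k)" for j k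
  define w where "w j n = W j (j + n)" for j n
  have w_z: "w j n (z i k) = (if i = j \<and> k = n then 1 else 0)" for j n i k
  proof -
    consider "i + k < j + n" | "i + k > j + n" | "i + k = j + n" by linarith
    then show ?thesis
    proof cases
      case 3
      \<comment> \<open>At equal times \<open>i \<le> j + n\<close>, so \<open>f i\<close> is among
        the elements on which \<open>w j n\<close> reproduces \<open>\<phi> j\<close>.\<close>
      then have "f i (w j n) = (if i = j then 1 else 0)"
        using w0(3)[OF finB, of i "j + n"] by (simp add: w_def W_def)
      then show ?thesis using 3
        by (auto simp: w_def z_def s_W blinfun.diff_right)
    qed (auto simp: w_def z_def s_W blinfun.diff_right)
  qed
  have w_norm: "norm (w j n) \<le> norm (\<phi> j) + 1" for j n
    unfolding w_def W_def by (rule w0(1)[OF finB])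
  have w_lim: "(\<lambda>n. w j n v) \<longlonglongrightarrow> 0" for j v
  proof -
    have "(\<lambda>n. w j n d) \<longlonglongrightarrow> (0 :: 'a \<Rightarrow>\<^sub>L real) d" if "d \<in> range x" for d
    proof -
      obtain q where q: "d = x q" using \<open>d \<in> range x\<close> by blast
      have "w j n d = 0" if "n \<ge> q" for n
      proof -
        have "d \<in> B (Suc q)" by (simp add: B_Suc q)
        then have "d \<in> B (Suc (j + n))" using monoB[of "Suc q" "Suc (j + n)"] that by auto
        then show ?thesis using w0(2)[OF finB] by (simp add: w_def W_def)
      qed
      then have "\<forall>\<^sub>F n in sequentially. w j n d = (0 :: 'a \<Rightarrow>\<^sub>L real) d"
        by (auto simp: eventually_sequentially)
      then show ?thesis by (rule tendsto_eventually)
    qed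
    from tendsto_on_dense[OF x w_norm this] show ?thesis by simp
  qed
  have partial: "norm (\<Sum>k<K. z j k) \<le> 2 * (norm (f j) + 1)" for j K
  proof -
    have "(\<Sum>k<K. z j k) = s j (j + K) - s j j"
      by (induction K) (simp_all add: z_def)
    moreover have "norm (s j i) \<le> norm (f j) + 1" for i
      unfolding s_def by (rule s0(1)[OF finA])
    ultimately show ?thesis using norm_triangle_ineq4[of "s j (j + K)" "s j j"]
      by (smt (verit))
  qed
  \<comment> \<open>After time \<open>q\<close> every approximant is exact on
    \<open>\<eta> q\<close>, which thus sees only increments with
    \<open>i + k \<le> q\<close>.\<close>
  have fin: "finite {(i, k). \<eta> q (z i k) \<noteq> 0}" for q
  proof (rule finite_subset)
    show "{(i, k). \<eta> q (z i k) \<noteq> 0} \<subseteq> {..q} \<times> {..q}"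
    proof clarify
      fix i k assume nz: "\<eta> q (z i k) \<noteq> 0"
      have "i + k \<le> q"
      proof (rule ccontr)
        assume "\<not> i + k \<le> q"
        moreover have "\<eta> q \<in> A (Suc q)" by (simp add: A_Suc)
        ultimately show False using nz by (simp add: z_def blinfun.diff_right s_A[of _ "Suc q"])
      qed
      then show "i \<in> {..q} \<and> k \<in> {..q}" by simp
    qed
  qed simp
  have "\<exists>s. (\<forall>n. finite {(i, k). blinfun_apply (s n) (z i k) \<noteq> 0}) \<and>
       (\<forall>x. (\<lambda>n. s n x) \<longlonglongrightarrow> y x)" for y :: "'a \<Rightarrow>\<^sub>L real"
  proof -
    from \<eta>[of y] obtain \<sigma> where "\<forall>x. (\<lambda>n. \<eta> (\<sigma> n) x) \<longlonglongrightarrow> y x" by blast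
    with fin show ?thesis by (intro exI[of _ "\<lambda>n. \<eta> (\<sigma> n)"]) simp
  qed
  from that[OF partial w_z w_lim this] show ?thesis .
qed

section \<open>The tower of derived sets\<close>

lemma wstar_derived_unfold:
  assumes "Well_order r"
  shows "wstar_derived r \<Gamma> i = (if \<forall>j. (j, i) \<notin> r - Id then \<Gamma>
    else (\<Union>j\<in>{j. (j, i) \<in> r - Id}. wstar_derived1 (wstar_derived r \<Gamma> j)))"
proof -
  have "wf (r - Id)" using assms by (simp add: well_order_on_def)
  then show ?thesis
    unfolding wstar_derived_def
    by (subst wfrec) (auto simp: cut_apply)
qed

lemma finite_subset_of_Well_order_has_max:
  assumes "Well_order r" "finite F" "F \<noteq> {}" "F \<subseteq> Field r"
  shows "\<exists>m\<in>F. \<forall>x\<in>F. (x, m) \<in> r"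
  using assms(2-4)
proof (induction F rule: finite_ne_induct)
  case (singleton x)
  then show ?case using assms(1)
    by (auto simp: order_on_defs refl_on_def)
next
  case (insert x F)
  then obtain m where m: "m \<in> F" "\<And>y. y \<in> F \<Longrightarrow> (y, m) \<in> r" by auto
  have "x \<in> Field r" "m \<in> Field r" "x \<noteq> m" using insert.prems insert.hyps m(1) by auto
  then have "(x, m) \<in> r \<or> (m, x) \<in> r" "(x, x) \<in> r"
    using assms(1) unfolding order_on_defs refl_on_def total_on_def by blast+
  moreover have "trans r" using assms(1) by (simp add: order_on_defs)
  ultimately show ?case
  proof (elim disjE)
    assume "(x, m) \<in> r"
    then show ?thesis using m by (intro bexI[of _ m]) auto
  next
    assume "(m, x) \<in> r" "trans r" "(x, x) \<in> r"
    then show ?thesis using m by (intro bexI[of _ x]) (auto dest: transD)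
  qed
qed

text \<open>\<open>g k\<close> is the \<open>r\<close>-greatest of \<open>e\<close> and the elements
  below \<open>b\<close> whose number is at most \<open>k\<close>; each \<open>c\<close> takes part
  from \<open>k = c\<close> on. The order of the numbers serves to enumerate the segment below
  \<open>b\<close>.\<close>

lemma fundamental_sequence:
  fixes r :: "(nat \<times> nat) set"
  assumes wo: "Well_order r" and e: "(e, b) \<in> r - Id"
  obtains g :: "nat \<Rightarrow> nat"
  where "\<And>k. (g k, b) \<in> r - Id" "\<And>c. (c, b) \<in> r - Id \<Longrightarrow> \<exists>K. \<forall>k\<ge>K. (c, g k) \<in> r"
proof -
  define F where "F k = insert e {c. (c, b) \<in> r - Id \<and> c \<le> k}" for k
  have "\<exists>m\<in>F k. \<forall>c\<in>F k. (c, m) \<in> r" for k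
  proof (rule finite_subset_of_Well_order_has_max[OF wo])
    show "finite (F k)" by (auto simp: F_def)
    show "F k \<subseteq> Field r" using e by (auto simp: F_def Field_def)
  qed (simp add: F_def)
  then obtain g where g: "\<And>k. g k \<in> F k" "\<And>k c. c \<in> F k \<Longrightarrow> (c, g k) \<in> r" by metis
  have "(g k, b) \<in> r - Id" for k using g(1)[of k] e by (auto simp: F_def)
  moreover have "\<forall>k\<ge>c. (c, g k) \<in> r" if "(c, b) \<in> r - Id" for c
    using g(2) \<open>(c, b) \<in> r - Id\<close> by (simp add: F_def)
  ultimately show ?thesis using that[of g] by blast
qed

text \<open>Ranks on the tree of finite sequences (root \<open>[]\<close>, \<open>k # t\<close> the \<open>k\<close>-th child of \<open>t\<close>):
  the children of a node of rank \<open>b\<close> have ranks cofinal in \<open>b\<close>; nodes below one of minimal rank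
  are unranked.\<close>
lemma rank_function:
  fixes r :: "(nat \<times> nat) set"
  assumes wo: "Well_order r"
  obtains rank :: "nat list \<Rightarrow> nat option"
  where "rank [] = Some a"
    "\<And>k t c. rank (k # t) = Some c \<Longrightarrow> \<exists>b. rank t = Some b \<and> (c, b) \<in> r - Id"
    "\<And>t b g. rank t = Some b \<Longrightarrow> (g, b) \<in> r - Id \<Longrightarrow>
       \<exists>K. \<forall>k\<ge>K. \<exists>c. rank (k # t) = Some c \<and> (g, c) \<in> r"
proof -
  define Q where "Q b g \<longleftrightarrow> (\<forall>k. (g k, b) \<in> r - Id) \<and>
      (\<forall>c. (c, b) \<in> r - Id \<longrightarrow> (\<exists>K. \<forall>k\<ge>K. (c, g k) \<in> r))" for b and g :: "nat \<Rightarrow> nat"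
  have "\<exists>g. (\<exists>e. (e, b) \<in> r - Id) \<longrightarrow> Q b g" for b
  proof (cases "\<exists>e. (e, b) \<in> r - Id")
    case True
    then obtain e where e: "(e, b) \<in> r - Id" by blast
    show ?thesis
    proof (rule fundamental_sequence[OF wo e])
      fix g :: "nat \<Rightarrow> nat"
      assume "\<And>k. (g k, b) \<in> r - Id"
        "\<And>c. (c, b) \<in> r - Id \<Longrightarrow> \<exists>K. \<forall>k\<ge>K. (c, g k) \<in> r"
      then have "Q b g" by (simp add: Q_def)
      then show ?thesis by blast
    qed
  qed blast
  then obtain fund where "\<And>b. (\<exists>e. (e, b) \<in> r - Id) \<longrightarrow> Q b (fund b)" by metis
  then have fund: "(e, b) \<in> r - Id \<Longrightarrow> (fund b k, b) \<in> r - Id"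
    "(c, b) \<in> r - Id \<Longrightarrow> \<exists>K. \<forall>k\<ge>K. (c, fund b k) \<in> r" for b e k c
    unfolding Q_def by blast+
  define rank where "rank = rec_list (Some a) (\<lambda>k t R. case R of None \<Rightarrow> None
    | Some b \<Rightarrow> if \<exists>e. (e, b) \<in> r - Id then Some (fund b k) else None)"
  have rank_Cons: "rank (k # t) = (case rank t of None \<Rightarrow> None
    | Some b \<Rightarrow> if \<exists>e. (e, b) \<in> r - Id then Some (fund b k) else None)" for k t
    unfolding rank_def by (simp only: list.rec)
  show ?thesis
  proof (rule that[of rank])
    show "rank [] = Some a" by (simp add: rank_def)
    show "\<exists>b. rank t = Some b \<and> (c, b) \<in> r - Id" if "rank (k # t) = Some c" for k t c
      using that fund(1) by (fastforce simp: rank_Cons split: option.splits if_splits)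
    show "\<exists>K. \<forall>k\<ge>K. \<exists>c. rank (k # t) = Some c \<and> (g, c) \<in> r"
      if t: "rank t = Some b" and g: "(g, b) \<in> r - Id" for t b g
    proof -
      have "rank (k # t) = Some (fund b k)" for k using t g by (auto simp: rank_Cons)
      then show ?thesis using fund(2)[OF g] by auto
    qed
  qed
qed

section \<open>The links and the subspace \<open>\<Gamma>\<close>\<close>

locale ranked_array =
  fixes r :: "('i \<times> 'i) set" and a :: 'i and rank :: "nat list \<Rightarrow> 'i option"
    and z :: "nat list \<Rightarrow> nat \<Rightarrow> 'a::banach" and C :: "nat list \<Rightarrow> real"
    and w :: "nat list \<Rightarrow> nat \<Rightarrow> 'a \<Rightarrow>\<^sub>L real"
  assumes wo: "Well_order r" and a_in: "a \<in> Field r"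
    and rank_Nil: "rank [] = Some a"
    and rank_Cons: "rank (k # t) = Some c \<Longrightarrow> \<exists>b. rank t = Some b \<and> (c, b) \<in> r - Id"
    and rank_cofinal: "rank t = Some b \<Longrightarrow> (g, b) \<in> r - Id \<Longrightarrow>
       \<exists>K. \<forall>k\<ge>K. \<exists>c. rank (k # t) = Some c \<and> (g, c) \<in> r"
    and partial_sums: "norm (\<Sum>k<K. z t k) \<le> C t"
    and w_z: "w t n (z u k) = (if u = t \<and> k = n then 1 else 0)"
    and w_null: "(\<lambda>n. w t n x) \<longlonglongrightarrow> 0"
    and finite_dense: "\<exists>s :: nat \<Rightarrow> 'a \<Rightarrow>\<^sub>L real. (\<forall>n. finite {(t, k). blinfun_apply (s n) (z t k) \<noteq> 0}) \<and>
       (\<forall>x. (\<lambda>n. s n x) \<longlonglongrightarrow> blinfun_apply y x)"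
begin

lemma trans_r: "(i, j) \<in> r \<Longrightarrow> (j, k) \<in> r \<Longrightarrow> (i, k) \<in> r"
  using wo by (auto simp: order_on_defs dest: transD)

lemma antisym_r: "(i, j) \<in> r \<Longrightarrow> (j, i) \<in> r \<Longrightarrow> i = j"
  using wo by (auto simp: order_on_defs dest: antisymD)

lemma wf_r: "wf (r - Id)"
  using wo by (simp add: well_order_on_def)

text \<open>The entry of the parent row to which row \<open>t\<close> is tied. The value 0 at the
  root makes its link say that the row sum vanishes.\<close>

definition node :: "nat list \<Rightarrow> 'a" where
  "node t = (case t of [] \<Rightarrow> 0 | k # u \<Rightarrow> z u k)"

text \<open>Dividing by \<open>C t + 1\<close> offsets the size of the row sum of \<open>t\<close>,
  so that the links of the children force decay \<open>(1/2)^k\<close> along the parent row.\<close>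

definition eps :: "nat list \<Rightarrow> real" where
  "eps t = (case t of [] \<Rightarrow> 1 | k # u \<Rightarrow> (1/2)^k / (C t + 1))"

definition linked :: "nat list \<Rightarrow> ('a \<Rightarrow>\<^sub>L real) \<Rightarrow> bool" where
  "linked t y \<longleftrightarrow> (\<lambda>k. eps t * y (z t k)) sums y (node t)"

definition \<Gamma> :: "('a \<Rightarrow>\<^sub>L real) set" where
  "\<Gamma> = {y. \<forall>t. rank t \<noteq> None \<longrightarrow> linked t y}"

lemma C_nonneg: "C t \<ge> 0"
  using partial_sums[where K=0 and t=t] by simp

lemma eps_pos: "eps t > 0"
  by (auto simp: eps_def add_nonneg_pos C_nonneg split: list.split)

lemma subspace_\<Gamma>: "subspace \<Gamma>"
proof -
  have "linked t 0" for t by (simp add: linked_def)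
  moreover have "linked t (y + y')" if "linked t y" "linked t y'" for t y y'
    using sums_add[of "\<lambda>k. eps t * y (z t k)" _ "\<lambda>k. eps t * y' (z t k)"] that
    by (simp add: linked_def blinfun.add_left distrib_left)
  moreover have "linked t (c *\<^sub>R y)" if "linked t y" for t c y
    using sums_mult[OF that[unfolded linked_def], of c]
    by (simp add: linked_def blinfun.scaleR_left mult.left_commute)
  ultimately show ?thesis by (simp add: subspace_def \<Gamma>_def)
qed

lemma suminf_bound:
  fixes y :: "'a \<Rightarrow>\<^sub>L real"
  assumes "(\<lambda>k. y (z t k)) sums S"
  shows "\<bar>S\<bar> \<le> C t * norm y"
proof (rule LIMSEQ_le_const2)
  show "(\<lambda>K. \<bar>\<Sum>k<K. y (z t k)\<bar>) \<longlonglongrightarrow> \<bar>S\<bar>"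
    using assms unfolding sums_def by (rule tendsto_rabs)
  have "\<bar>\<Sum>k<K. y (z t k)\<bar> \<le> C t * norm y" for K
  proof -
    have "\<bar>\<Sum>k<K. y (z t k)\<bar> \<le> norm y * norm (\<Sum>k<K. z t k)"
      using norm_blinfun[of y "\<Sum>k<K. z t k"] by (simp add: blinfun.sum_right)
    also have "\<dots> \<le> norm y * C t" by (intro mult_left_mono partial_sums) simp
    finally show ?thesis by (simp add: mult.commute)
  qed
  then show "\<exists>N. \<forall>K\<ge>N. \<bar>\<Sum>k<K. y (z t k)\<bar> \<le> C t * norm y" by blast
qed

text \<open>The link trades the value \<open>y (z t k)\<close> for \<open>eps\<close> times a row
  sum, which \<open>suminf_bound\<close> controls.\<close>

lemma linked_bound:
  assumes "linked (k # t) y"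
  shows "\<bar>y (z t k)\<bar> \<le> (1/2)^k * norm y"
proof -
  let ?u = "k # t"
  have "(\<lambda>l. y (z ?u l)) sums (y (node ?u) / eps ?u)"
    using sums_mult[OF assms[unfolded linked_def], of "1 / eps ?u"] eps_pos[of ?u] by simp
  then have "\<bar>y (node ?u) / eps ?u\<bar> \<le> C ?u * norm y" by (rule suminf_bound)
  then have "\<bar>y (z t k)\<bar> \<le> eps ?u * (C ?u * norm y)"
    using eps_pos[of ?u] by (simp add: node_def abs_divide divide_le_eq mult.commute)
  also have "\<dots> = (1/2)^k * norm y * (C ?u / (C ?u + 1))" by (simp add: eps_def)
  also have "\<dots> \<le> (1/2)^k * norm y"
    using C_nonneg[of ?u] by (intro mult_left_le) auto
  finally show ?thesis .
qed

text \<open>At a node of rank \<open>c > g\<close> the links of almost all children make the series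
  \<open>\<Sum>k. y (z t k)\<close> uniformly summable on bounded subsets of \<open>\<Gamma>\<^sub>(\<^sub>g\<^sub>)\<close>,
  so the link of \<open>t\<close> survives one more weak* sequential limit.\<close>
lemma linked_persists:
  "y \<in> wstar_derived r \<Gamma> b \<Longrightarrow> rank t = Some c \<Longrightarrow> (b, c) \<in> r \<Longrightarrow> linked t y"
proof (induction b arbitrary: y t c rule: wf_induct_rule[OF wf_r])
  case (1 b)
  show ?case
  proof (cases "\<forall>j. (j, b) \<notin> r - Id")
    case True
    then have "y \<in> \<Gamma>" using 1(2) by (simp add: wstar_derived_unfold[OF wo, of _ b])
    then show ?thesis using 1(3) by (simp add: \<Gamma>_def)
  next
    case False
    then have "y \<in> (\<Union>j\<in>{j. (j, b) \<in> r - Id}. wstar_derived1 (wstar_derived r \<Gamma> j))"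
      using 1(2) by (simp only: wstar_derived_unfold[OF wo, of _ b] if_False)
    then obtain g where g: "(g, b) \<in> r - Id" "y \<in> wstar_derived1 (wstar_derived r \<Gamma> g)" by blast
    then obtain s where s: "\<And>n. s n \<in> wstar_derived r \<Gamma> g" "\<And>x. (\<lambda>n. s n x) \<longlonglongrightarrow> y x"
      by (auto simp: wstar_derived1_def)
    obtain M where M: "M \<ge> 0" "\<And>n. norm (s n) \<le> M"
      using pointwise_bounded_imp_norm_bounded s(2) convergent_imp_bounded by metis
    have gc: "(g, c) \<in> r - Id" using g(1) 1(4) trans_r antisym_r by blast
    \<comment> \<open>The ranks of these children are not below \<open>g\<close>, so by induction
      their links hold on the derived set at \<open>g\<close>.\<close>
    obtain K where K: "\<And>k. k \<ge> K \<Longrightarrow> \<exists>c. rank (k # t) = Some c \<and> (g, c) \<in> r"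
      using rank_cofinal[OF 1(3) gc] by blast
    \<comment> \<open>A majorant for Tannery's theorem, uniform in \<open>n\<close>: crude norms
      cover the first \<open>K\<close> entries, geometric decay the others.\<close>
    define bound where "bound k = eps t * (M * ((if k \<in> {..<K} then norm (z t k) else 0) + (1/2)^k))" for k
    have "norm (eps t * s n (z t k)) \<le> bound k" for k n
    proof -
      have "\<bar>s n (z t k)\<bar> \<le> M * ((if k \<in> {..<K} then norm (z t k) else 0) + (1/2)^k)"
      proof (cases "k < K")
        case True
        have "\<bar>s n (z t k)\<bar> \<le> norm (s n) * norm (z t k)"
          using norm_blinfun[of "s n" "z t k"] by simp
        also have "\<dots> \<le> M * (norm (z t k) + (1/2)^k)"
          using M by (intro mult_mono) auto
        finally show ?thesis using True by simp
      next
        case False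
        then have "linked (k # t) (s n)" using K[of k] 1(1)[OF g(1) s(1)] by auto
        then have "\<bar>s n (z t k)\<bar> \<le> (1/2)^k * norm (s n)" by (rule linked_bound)
        also have "\<dots> \<le> (1/2)^k * M" using M by (intro mult_left_mono) auto
        finally show ?thesis using False by (simp add: mult.commute)
      qed
      then show ?thesis using eps_pos[of t] by (simp add: bound_def abs_mult)
    qed
    moreover have "summable bound"
      unfolding bound_def
      by (intro summable_mult summable_add summable_If_finite_set) (auto intro: summable_geometric)
    ultimately have T: "summable (\<lambda>k. norm (eps t * y (z t k)))"
      "(\<lambda>n. \<Sum>k. eps t * s n (z t k)) \<longlonglongrightarrow> (\<Sum>k. eps t * y (z t k))"
      using tannerys_theorem[where a = "\<lambda>k n. eps t * s n (z t k)" and b = "\<lambda>k. eps t * y (z t k)"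
          and F = sequentially and M = bound, OF tendsto_mult_left[OF s(2)] always_eventually]
      by simp_all
    have "linked t (s n)" for n using 1(1)[OF g(1) s(1) 1(3)] gc by blast
    then have "(\<Sum>k. eps t * s n (z t k)) = s n (node t)" for n
      unfolding linked_def by (metis sums_unique)
    then have "(\<Sum>k. eps t * y (z t k)) = y (node t)"
      using T(2) s(2)[of "node t"] LIMSEQ_unique by simp
    then show ?thesis
      unfolding linked_def using summable_norm_cancel[OF T(1)] summable_sums by metis
  qed
qed

text \<open>Its row sum at the root is 1, whereas the root link, which persists up to the rank
  \<open>a\<close> of the root, demands 0.\<close>

lemma root_functional_notin_derived: "w [] 0 \<notin> wstar_derived r \<Gamma> a"
proof
  assume "w [] 0 \<in> wstar_derived r \<Gamma> a"
  moreover have "(a, a) \<in> r" using wo a_in by (auto simp: order_on_defs refl_on_def)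
  ultimately have "linked [] (w [] 0)" using linked_persists rank_Nil by blast
  then have "(\<lambda>k. if k = 0 then 1 else 0 :: real) sums 0"
    by (simp add: linked_def eps_def node_def w_z)
  moreover have "(\<lambda>k. if k = 0 then 1 else 0 :: real) sums 1" by (rule sums_single)
  ultimately show False using sums_unique2 by fastforce
qed

section \<open>Repairing broken links\<close>

definition broken :: "('a \<Rightarrow>\<^sub>L real) \<Rightarrow> nat list set" where
  "broken y = {t. rank t \<noteq> None \<and> \<not> linked t y}"

text \<open>A sufficient condition for lying in the derived set at \<open>b\<close>, stated so that
  finite corrections can lower \<open>b\<close>; at the least \<open>b\<close> no link may be
  broken.\<close>

definition nearly_linked :: "'i \<Rightarrow> ('a \<Rightarrow>\<^sub>L real) \<Rightarrow> bool" where
  "nearly_linked b y \<longleftrightarrow> (\<forall>t. summable (\<lambda>k. y (z t k))) \<and> finite (broken y) \<and>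
     (\<forall>t\<in>broken y. (the (rank t), b) \<in> r - Id)"

text \<open>The amount missing from the row sum for the link at \<open>t\<close> to hold.\<close>

definition defect :: "('a \<Rightarrow>\<^sub>L real) \<Rightarrow> nat list \<Rightarrow> real" where
  "defect y t = y (node t) / eps t - (\<Sum>k. y (z t k))"

lemma linked_iff:
  fixes y :: "'a \<Rightarrow>\<^sub>L real"
  assumes "summable (\<lambda>k. y (z t k))"
  shows "linked t y \<longleftrightarrow> eps t * (\<Sum>k. y (z t k)) = y (node t)"
  using sums_mult[OF summable_sums[OF assms], of "eps t"]
  unfolding linked_def by (auto dest: sums_unique2)

text \<open>Adding \<open>defect y t\<close> times \<open>w t n\<close> alters just entry
  \<open>n\<close> of row \<open>t\<close>. That closes the link at \<open>t\<close> and can break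
  only the one at \<open>n # t\<close>, whose rank, if any, is below \<open>g\<close>.\<close>

lemma nearly_linked_repair:
  fixes y :: "'a \<Rightarrow>\<^sub>L real"
  assumes summ: "\<And>t. summable (\<lambda>k. y (z t k))" and fin: "finite (broken y)"
    and le: "\<And>t. t \<in> broken y \<Longrightarrow> (the (rank t), g) \<in> r"
  shows "nearly_linked g (y + (\<Sum>t | t \<in> broken y \<and> rank t = Some g. defect y t *\<^sub>R w t n))"
proof -
  define F where "F = {t \<in> broken y. rank t = Some g}"
  define Y where "Y = y + (\<Sum>t\<in>F. defect y t *\<^sub>R w t n)"
  have finF: "finite F" using fin by (simp add: F_def)
  have Y_z: "Y (z t k) = y (z t k) + (if k = n then (if t \<in> F then defect y t else 0) else 0)" for t k
  proof -
    have "(\<Sum>u\<in>F. defect y u * w u n (z t k))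
        = (\<Sum>u\<in>F. if t = u then (if k = n then defect y u else 0) else 0)"
      by (intro sum.cong) (auto simp: w_z)
    then show ?thesis
      using finF by (simp add: Y_def blinfun.bilinear_simps blinfun.sum_left)
  qed
  have Y_sums: "(\<lambda>k. Y (z t k)) sums ((\<Sum>k. y (z t k)) + (if t \<in> F then defect y t else 0))" for t
    unfolding Y_z by (intro sums_add summable_sums summ sums_single)
  have summY: "summable (\<lambda>k. Y (z t k))" for t using Y_sums by (rule sums_summable)
  have Y_linked: "linked t Y \<longleftrightarrow>
      eps t * ((\<Sum>k. y (z t k)) + (if t \<in> F then defect y t else 0)) = Y (node t)" for t
    using linked_iff[OF summY] sums_unique[OF Y_sums] by metis
  have node_change: "\<exists>u\<in>F. t = n # u" if "Y (node t) \<noteq> y (node t)" for t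
    using that by (cases t) (auto simp: node_def Y_z split: if_splits)
  have child_rank: "(c, g) \<in> r - Id" if "u \<in> F" "rank (k # u) = Some c" for u k c
    using rank_Cons[OF that(2)] that(1) by (auto simp: F_def)
  \<comment> \<open>The corrections do not interfere: all nodes of \<open>F\<close> have rank
    \<open>g\<close>, so none is a child of another.\<close>
  have linkedF: "linked t Y" if "t \<in> F" for t
  proof -
    have "Y (node t) = y (node t)"
    proof (rule ccontr)
      assume "Y (node t) \<noteq> y (node t)"
      then obtain u where "u \<in> F" "t = n # u" using node_change by blast
      then show False using child_rank[of u n g] that by (simp add: F_def)
    qed
    then show ?thesis using that eps_pos[of t] by (simp add: Y_linked defect_def)
  qed
  have broken_cases: "t \<in> broken y - F \<or> (\<exists>u\<in>F. t = n # u)" if "t \<in> broken Y" for t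
  proof (cases "t \<in> broken y")
    case True
    then show ?thesis using linkedF that by (auto simp: broken_def)
  next
    case False
    then have "linked t y" "t \<notin> F" using that by (auto simp: broken_def F_def)
    then have "Y (node t) \<noteq> y (node t)"
      using that linked_iff[OF summ, of t] Y_linked[of t] by (auto simp: broken_def)
    then show ?thesis using node_change by blast
  qed
  have "finite (broken Y)"
    by (rule finite_subset[of _ "broken y \<union> (\<lambda>u. n # u) ` F"])
      (use broken_cases fin finF in auto)
  moreover have "(the (rank t), g) \<in> r - Id" if t: "t \<in> broken Y" for t
  proof -
    obtain c where c: "rank t = Some c" using t by (auto simp: broken_def)
    from broken_cases[OF t] show ?thesis
    proof
      assume "t \<in> broken y - F"
      then show ?thesis using le[of t] c by (auto simp: F_def)
    next
      assume "\<exists>u\<in>F. t = n # u"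
      then show ?thesis using child_rank c by auto
    qed
  qed
  ultimately have "nearly_linked g Y" using summY by (simp add: nearly_linked_def)
  then show ?thesis by (simp add: Y_def F_def)
qed

text \<open>Induction on \<open>b\<close>: choose \<open>g\<close> below \<open>b\<close> bounding
  the ranks of the broken links. Repairing those of rank \<open>g\<close> in column \<open>n\<close>
  leads into the derived set at \<open>g\<close>, and the corrections tend weak* to 0 as
  \<open>n\<close> grows.\<close>

lemma nearly_linked_in_derived: "nearly_linked b y \<Longrightarrow> y \<in> wstar_derived r \<Gamma> b"
proof (induction b arbitrary: y rule: wf_induct_rule[OF wf_r])
  case (1 b)
  note summ = 1(2)[unfolded nearly_linked_def, THEN conjunct1, rule_format]
  have fin: "finite (broken y)" and lt: "\<And>t. t \<in> broken y \<Longrightarrow> (the (rank t), b) \<in> r - Id"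
    using 1(2) by (auto simp: nearly_linked_def)
  show ?case
  proof (cases "\<forall>j. (j, b) \<notin> r - Id")
    case True
    then have "broken y = {}" using lt by blast
    then have "y \<in> \<Gamma>" unfolding broken_def \<Gamma>_def by blast
    then show ?thesis using True by (simp add: wstar_derived_unfold[OF wo, of _ b])
  next
    case False
    then obtain e where e: "(e, b) \<in> r - Id" by blast
    \<comment> \<open>Including \<open>e\<close> provides a \<open>g\<close> even when no link is
      broken.\<close>
    let ?R = "insert e ((\<lambda>t. the (rank t)) ` broken y)"
    have R: "\<And>c. c \<in> ?R \<Longrightarrow> (c, b) \<in> r - Id" using e lt by blast
    then have "?R \<subseteq> Field r" unfolding Field_def by blast
    then obtain g where g: "g \<in> ?R" "\<And>c. c \<in> ?R \<Longrightarrow> (c, g) \<in> r"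
      using finite_subset_of_Well_order_has_max[OF wo, of ?R] fin by auto
    define Y where "Y n = y + (\<Sum>t | t \<in> broken y \<and> rank t = Some g. defect y t *\<^sub>R w t n)" for n
    have "nearly_linked g (Y n)" for n
      unfolding Y_def using g(2) by (intro nearly_linked_repair summ fin) auto
    then have "Y n \<in> wstar_derived r \<Gamma> g" for n using 1(1)[OF R[OF g(1)]] by blast
    moreover have "(\<lambda>n. Y n x) \<longlonglongrightarrow> y x" for x
    proof -
      have "(\<lambda>n. y x + (\<Sum>t | t \<in> broken y \<and> rank t = Some g. defect y t * w t n x)) \<longlonglongrightarrow>
        y x + (\<Sum>t | t \<in> broken y \<and> rank t = Some g. defect y t * 0)"
        by (intro tendsto_intros w_null)
      then show ?thesis by (simp add: Y_def blinfun.bilinear_simps blinfun.sum_left)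
    qed
    ultimately have "y \<in> wstar_derived1 (wstar_derived r \<Gamma> g)"
      by (auto simp: wstar_derived1_def)
    then show ?thesis
      using False R[OF g(1)] by (subst wstar_derived_unfold[OF wo]) auto
  qed
qed

lemma rank_Cons_less: "rank (k # t) = Some c \<Longrightarrow> (c, a) \<in> r - Id"
proof (induction t arbitrary: k c)
  case Nil
  then show ?case using rank_Cons[OF Nil] rank_Nil by simp
next
  case (Cons l t)
  then show ?case using rank_Cons[OF Cons.prems] trans_r antisym_r by blast
qed

text \<open>Any \<open>y\<close> is a weak* limit of functionals with finite support on the array,
  whose broken links are finitely many and of rank at most \<open>a\<close>. Repairing the root adds
  a bounded multiple of \<open>w [] n\<close>, which does not change the limit.\<close>

lemma derived_eq_UNIV:
  assumes am: "(a, m) \<in> r - Id"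
  shows "wstar_derived r \<Gamma> m = UNIV"
proof -
  have "y \<in> wstar_derived r \<Gamma> m" for y :: "'a \<Rightarrow>\<^sub>L real"
  proof -
    obtain s where s: "\<And>n. finite {(t, k). blinfun_apply (s n) (z t k) \<noteq> 0}"
      "\<And>x. (\<lambda>n. s n x) \<longlonglongrightarrow> blinfun_apply y x"
      using finite_dense[of y] by blast
    obtain M where M: "M \<ge> 0" "\<And>n. norm (s n) \<le> M"
      using pointwise_bounded_imp_norm_bounded s(2) convergent_imp_bounded by metis
    have summ: "summable (\<lambda>k. s n (z t k))" for n t
    proof (rule summable_finite)
      show "finite {k. s n (z t k) \<noteq> 0}"
        by (rule finite_subset[OF _ finite_imageI[OF s(1)[of n], of snd]]) force
    qed auto
    \<comment> \<open>The link at \<open>t\<close> involves row \<open>t\<close> and one entry of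
      its parent row, so off the support it reads \<open>0 = 0\<close>.\<close>
    have fin: "finite (broken (s n))" for n
    proof (rule finite_subset)
      let ?E = "{(t, k). blinfun_apply (s n) (z t k) \<noteq> 0}"
      show "finite (fst ` ?E \<union> (\<lambda>(t, k). k # t) ` ?E)" using s(1) by blast
      show "broken (s n) \<subseteq> fst ` ?E \<union> (\<lambda>(t, k). k # t) ` ?E"
      proof
        fix t assume t: "t \<in> broken (s n)"
        show "t \<in> fst ` ?E \<union> (\<lambda>(t, k). k # t) ` ?E"
        proof (rule ccontr)
          assume no: "t \<notin> fst ` ?E \<union> (\<lambda>(t, k). k # t) ` ?E"
          then have "s n (z t k) = 0" for k by (force simp: image_iff)
          moreover have "s n (node t) = 0"
            using no by (cases t) (force simp: node_def image_iff)+
          ultimately have "linked t (s n)" by (simp add: linked_def)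
          then show False using t by (simp add: broken_def)
        qed
      qed
    qed
    have aa: "(a, a) \<in> r" using wo a_in by (auto simp: order_on_defs refl_on_def)
    have le: "(the (rank t), a) \<in> r" if "t \<in> broken (s n)" for n t
      using that rank_Cons_less rank_Nil aa by (cases t) (auto simp: broken_def)
    define \<delta> where "\<delta> n = (if [] \<in> broken (s n) then defect (s n) [] else 0)" for n
    \<comment> \<open>The root is the only node of rank \<open>a\<close>, so the repair has at most
      one term.\<close>
    have "{t \<in> broken (s n). rank t = Some a} = (if [] \<in> broken (s n) then {[]} else {})" for n
      using rank_Cons_less rank_Nil by (auto simp: neq_Nil_conv) (metis DiffD2 IdI list.exhaust)+
    then have "(\<Sum>t | t \<in> broken (s n) \<and> rank t = Some a. defect (s n) t *\<^sub>R w t n) = \<delta> n *\<^sub>R w [] n" for n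
      by (simp add: \<delta>_def)
    moreover have "nearly_linked a
        (s n + (\<Sum>t | t \<in> broken (s n) \<and> rank t = Some a. defect (s n) t *\<^sub>R w t n))" for n
      by (rule nearly_linked_repair[OF summ fin le])
    ultimately have "nearly_linked a (s n + \<delta> n *\<^sub>R w [] n)" for n by metis
    then have "s n + \<delta> n *\<^sub>R w [] n \<in> wstar_derived r \<Gamma> a" for n
      by (rule nearly_linked_in_derived)
    moreover have "(\<lambda>n. (s n + \<delta> n *\<^sub>R w [] n) x) \<longlonglongrightarrow> y x" for x
    proof -
      \<comment> \<open>At the root \<open>node\<close> is 0 and \<open>eps\<close> is 1, so the
        defect is minus the row sum; the bound must be uniform because the coefficient varies with
        \<open>n\<close>.\<close>
      have \<delta>: "\<bar>\<delta> n\<bar> \<le> C [] * M" for n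
      proof -
        have "\<bar>\<Sum>k. s n (z [] k)\<bar> \<le> C [] * norm (s n)"
          by (intro suminf_bound summable_sums summ)
        also have "\<dots> \<le> C [] * M" by (intro mult_left_mono M C_nonneg)
        finally show ?thesis using C_nonneg[of "[]"] M(1) by (simp add: \<delta>_def defect_def node_def)
      qed
      have "(\<lambda>n. \<delta> n * w [] n x) \<longlonglongrightarrow> 0"
      proof (rule Lim_null_comparison)
        show "\<forall>\<^sub>F n in sequentially. norm (\<delta> n * w [] n x) \<le> (C [] * M) * \<bar>w [] n x\<bar>"
          using \<delta> by (intro always_eventually allI) (simp add: abs_mult mult_right_mono)
        show "(\<lambda>n. (C [] * M) * \<bar>w [] n x\<bar>) \<longlonglongrightarrow> 0"
          using w_null by (intro tendsto_mult_right_zero tendsto_rabs_zero)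
      qed
      from tendsto_add[OF s(2)[of x] this] show ?thesis by (simp add: blinfun.bilinear_simps)
    qed
    ultimately have "y \<in> wstar_derived1 (wstar_derived r \<Gamma> a)"
      unfolding wstar_derived1_def mem_Collect_eq
      by (intro exI[of _ "\<lambda>n. s n + \<delta> n *\<^sub>R w [] n"]) simp
    then show ?thesis using am by (subst wstar_derived_unfold[OF wo]) auto
  qed
  then show ?thesis by blast
qed

end

text \<open>Positions encode ordinals: if the segment below \<open>a\<close> has type \<alpha>, the
  one below its immediate successor \<open>m\<close>, the last element, has type \<alpha> + 1. Every
  countable \<alpha> arises from some such \<open>r\<close>.\<close>

theorem mainTheorem1:
  fixes r :: "(nat \<times> nat) set" and a m :: nat
  assumes sep: "separable_space (euclidean :: 'a::banach topology)"
    and nqr: "\<not> quasireflexive TYPE('a)"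
    and wo: "Well_order r"
    and a_in: "a \<in> Field r" and m_in: "m \<in> Field r"
    and am: "(a, m) \<in> r" "a \<noteq> m"
    and m_max: "\<forall>j\<in>Field r. (j, m) \<in> r"
    and a_pred: "\<forall>j. (j, m) \<in> r \<and> j \<noteq> m \<longrightarrow> (j, a) \<in> r"
  shows "\<exists>\<Gamma> :: ('a \<Rightarrow>\<^sub>L real) set. subspace \<Gamma> \<and>
           wstar_derived r \<Gamma> a \<noteq> wstar_derived r \<Gamma> m \<and>
           wstar_derived r \<Gamma> m = UNIV"
proof -
  obtain z :: "nat \<Rightarrow> nat \<Rightarrow> 'a" and C w where
    C: "\<And>j K. norm (\<Sum>k<K. z j k) \<le> C j"
    and w_z: "\<And>j n i k. blinfun_apply (w j n) (z i k) = (if i = j \<and> k = n then 1 else 0 :: real)"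
    and w_null: "\<And>j x. (\<lambda>n. w j n x) \<longlonglongrightarrow> 0"
    and dense: "\<And>y :: 'a \<Rightarrow>\<^sub>L real. \<exists>s. (\<forall>n. finite {(i, k). blinfun_apply (s n) (z i k) \<noteq> 0}) \<and>
       (\<forall>x. (\<lambda>n. s n x) \<longlonglongrightarrow> y x)"
    by (rule Davis_Johnson_array[OF sep nqr]) (rule that, assumption+)
  obtain rank :: "nat list \<Rightarrow> nat option" where rank:
    "rank [] = Some a"
    "\<And>k t c. rank (k # t) = Some c \<Longrightarrow> \<exists>b. rank t = Some b \<and> (c, b) \<in> r - Id"
    "\<And>t b g. rank t = Some b \<Longrightarrow> (g, b) \<in> r - Id \<Longrightarrow>
       \<exists>K. \<forall>k\<ge>K. \<exists>c. rank (k # t) = Some c \<and> (g, c) \<in> r"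
    by (rule rank_function[OF wo]) (rule that, assumption+)
  \<comment> \<open>Nodes are coded as row indices by the injection \<open>to_nat\<close>, which
    keeps supports finite.\<close>
  have tree_dense: "\<exists>s :: nat \<Rightarrow> 'a \<Rightarrow>\<^sub>L real.
      (\<forall>n. finite {(t :: nat list, k). blinfun_apply (s n) (z (to_nat t) k) \<noteq> 0}) \<and>
      (\<forall>x. (\<lambda>n. s n x) \<longlonglongrightarrow> y x)" for y :: "'a \<Rightarrow>\<^sub>L real"
  proof -
    obtain s :: "nat \<Rightarrow> 'a \<Rightarrow>\<^sub>L real"
      where s: "\<And>n. finite {(i, k). blinfun_apply (s n) (z i k) \<noteq> 0}"
        "\<And>x. (\<lambda>n. s n x) \<longlonglongrightarrow> y x"
      using dense[of y] by blast
    have "finite {(t :: nat list, k). blinfun_apply (s n) (z (to_nat t) k) \<noteq> 0}" for n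
    proof -
      have "{(t :: nat list, k). blinfun_apply (s n) (z (to_nat t) k) \<noteq> 0}
          = map_prod to_nat id -` {(i, k). blinfun_apply (s n) (z i k) \<noteq> 0}" by auto
      moreover have "inj (map_prod (to_nat :: nat list \<Rightarrow> nat) (id :: nat \<Rightarrow> nat))"
        by (intro prod.inj_map inj_to_nat inj_on_id)
      ultimately show ?thesis using finite_vimageI[OF s(1)] by metis
    qed
    then show ?thesis using s(2) by blast
  qed
  interpret ranked_array r a rank "\<lambda>t. z (to_nat t)" "\<lambda>t. C (to_nat t)" "\<lambda>t. w (to_nat t)"
    by (rule ranked_array.intro) (fact wo a_in rank C w_null tree_dense | simp add: w_z)+
  have "wstar_derived r \<Gamma> m = UNIV" using am by (intro derived_eq_UNIV) simp
  then show ?thesis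
    using subspace_\<Gamma> root_functional_notin_derived by blast
qed

end
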